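(* For $n, m \geq 3$, $e_{cc}(K_m \Box K_n) = 3$.
   Context: $K_k$ is the complete graph on $k$ vertices and $\Box$ the Cartesian product ($(g_1,h_1)\sim(g_2,h_2)$ iff $g_1g_2$ is an edge and $h_1=h_2$, or $g_1=g_2$ and $h_1h_2$ is an edge). Cycle convexity: for $S\subseteq V(X)$, a vertex $v\notin S$ is in the cycle interval of $S$ if $X[S\cup\{v\}]$ contains a cycle through $v$; $S$ is cycle convex if no vertex outside $S$ is in its cycle interval; $\langle S\rangle_{cc}$ is the smallest cycle convex set containing $S$. A nonempty set $S$ is $E$-independent if $|S|=1$ or there exist $p\in S$ and $p'\in \langle S\setminus\{p\}\rangle_{cc}\setminus \bigcup_{a\in S\setminus\{p\}}\langle S\setminus\{a\}\rangle_{cc}$. The exchange number $e_{cc}(X)$ is the maximum cardinality of an $E$-independent set of $X$. *)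

theory Defs
  imports "Graph_Theory.Graph_Theory"
begin

text \<open>
  A simple graph is represented by a symmetric loop-free digraph without parallel arcs
  (\<open>graph\<close>, \<open>pair_graph\<close>): each edge is a pair of opposite arcs.
\<close>

definition cartesian_product ::
    "'a pair_pre_digraph \<Rightarrow> 'b pair_pre_digraph \<Rightarrow> ('a \<times> 'b) pair_pre_digraph"
    (infixl \<open>\<box>\<close> 70) where
  "G \<box> H = \<lparr> pverts = pverts G \<times> pverts H,
     parcs = {((g1, h1), (g2, h2)) | g1 h1 g2 h2.
       (g1, g2) \<in> parcs G \<and> h1 = h2 \<and> h1 \<in> pverts H \<or>
       g1 = g2 \<and> g1 \<in> pverts G \<and> (h1, h2) \<in> parcs H} \<rparr>"

text \<open>
  The predicate \<open>cycle\<close> for digraphs admits the closed walk of length 2 that runs through an edge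
  and back. In a loop-free symmetric digraph without parallel arcs the closed directed walks
  without repeated vertices that have length at least 3 are exactly the (oriented) cycles of the
  underlying simple graph.
\<close>

definition cycle_through :: "('a, 'b) pre_digraph \<Rightarrow> 'a \<Rightarrow> bool" where
  "cycle_through X v \<longleftrightarrow>
     (\<exists>p. pre_digraph.cycle X p \<and> 3 \<le> length p \<and> v \<in> tail X ` set p)"

definition cycle_interval :: "('a, 'b) pre_digraph \<Rightarrow> 'a set \<Rightarrow> 'a set" where
  "cycle_interval X S = {v \<in> verts X - S. cycle_through (X \<restriction> (S \<union> {v})) v}"

definition cycle_convex :: "('a, 'b) pre_digraph \<Rightarrow> 'a set \<Rightarrow> bool" where
  "cycle_convex X S \<longleftrightarrow> S \<subseteq> verts X \<and> cycle_interval X S = {}"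

definition cycle_hull :: "('a, 'b) pre_digraph \<Rightarrow> 'a set \<Rightarrow> 'a set" where
  "cycle_hull X S = cycle_convex X hull S"

lemma cycle_through_mono:
  assumes "cycle_through (X \<restriction> A) v" "A \<subseteq> B"
  shows "cycle_through (X \<restriction> B) v"
proof -
  obtain p u where p: "pre_digraph.awalk (X \<restriction> A) u p u"
      "distinct (tl (pre_digraph.awalk_verts (X \<restriction> A) u p))" "p \<noteq> []"
      "3 \<le> length p" "v \<in> tail X ` set p"
    using assms(1) by (auto simp: cycle_through_def pre_digraph.cycle_def)
  have cas: "pre_digraph.cas (X \<restriction> C) a q b = pre_digraph.cas X a q b" for C a q b
    by (induct q arbitrary: a) (simp_all add: pre_digraph.cas.simps)
  have averts: "pre_digraph.awalk_verts (X \<restriction> C) a q = pre_digraph.awalk_verts X a q" for C a q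
    by (induct q arbitrary: a) (simp_all add: pre_digraph.awalk_verts.simps)
  have "pre_digraph.awalk (X \<restriction> B) u p u"
    using p(1) assms(2) by (auto simp: pre_digraph.awalk_def cas)
  moreover have "distinct (tl (pre_digraph.awalk_verts (X \<restriction> B) u p))"
    using p(2) by (simp add: averts)
  ultimately show ?thesis
    using p(3-5) unfolding cycle_through_def pre_digraph.cycle_def by auto
qed

lemma cycle_convex_Inter:
  assumes "\<And>C. C \<in> F \<Longrightarrow> cycle_convex X C" "F \<noteq> {}"
  shows "cycle_convex X (\<Inter>F)"
proof -
  have "False" if v: "v \<in> cycle_interval X (\<Inter>F)" for v
  proof -
    obtain C where C: "C \<in> F" "v \<notin> C" using v by (auto simp: cycle_interval_def)
    have "cycle_through (X \<restriction> (C \<union> {v})) v"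
      by (rule cycle_through_mono[of _ "\<Inter>F \<union> {v}"]) (use v C in \<open>auto simp: cycle_interval_def\<close>)
    then have "v \<in> cycle_interval X C" using v C by (auto simp: cycle_interval_def)
    then show False using assms(1)[OF C(1)] by (auto simp: cycle_convex_def)
  qed
  moreover have "\<Inter>F \<subseteq> verts X" using assms by (auto simp: cycle_convex_def)
  ultimately show ?thesis by (auto simp: cycle_convex_def)
qed

lemma cycle_hull_least:
  assumes "S \<subseteq> verts X"
  shows "cycle_convex X (cycle_hull X S)" "S \<subseteq> cycle_hull X S"
    "\<And>C. cycle_convex X C \<Longrightarrow> S \<subseteq> C \<Longrightarrow> cycle_hull X S \<subseteq> C"
proof -
  have "cycle_convex X (verts X)" by (auto simp: cycle_convex_def cycle_interval_def)
  then show "cycle_convex X (cycle_hull X S)"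
    unfolding cycle_hull_def hull_def using assms by (intro cycle_convex_Inter) auto
  show "S \<subseteq> cycle_hull X S" by (simp add: cycle_hull_def hull_subset)
  show "cycle_hull X S \<subseteq> C" if "cycle_convex X C" "S \<subseteq> C" for C
    using that by (simp add: cycle_hull_def hull_minimal)
qed

definition E_independent :: "('a, 'b) pre_digraph \<Rightarrow> 'a set \<Rightarrow> bool" where
  "E_independent X S \<longleftrightarrow> S \<subseteq> verts X \<and> S \<noteq> {} \<and>
     (card S = 1 \<or>
      (\<exists>p\<in>S. \<exists>p'. p' \<in> cycle_hull X (S - {p}) - (\<Union>a\<in>S - {p}. cycle_hull X (S - {a}))))"

text \<open>Only meaningful for finite graphs, where the maximum exists.\<close>

definition exchange_number :: "('a, 'b) pre_digraph \<Rightarrow> nat" where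
  "exchange_number X = Max {card S | S. E_independent X S}"

end

theory Submission
  imports Defs
begin

text \<open>
  Call the fibres of the two projections of \<open>K\<^sub>m \<box> K\<^sub>n\<close> lines; two distinct vertices are adjacent iff
  they share a line. A convex set that contains two points of a line contains the line, and if it
  contains a further vertex it is everything; independent sets and lines are convex.

  Suppose that \<open>|S| \<ge> 4\<close> is \<open>E\<close>-independent with witnesses \<open>p\<close> and \<open>p'\<close>. Then \<open>p' \<notin> S - {p}\<close>, so
  \<open>S - {p}\<close> is not convex and has two points \<open>x, y\<close> on a line \<open>L\<close>. For a third point \<open>a\<close> of
  \<open>S - {p}\<close>, the hull of \<open>S - {a}\<close> avoids \<open>p'\<close>, hence equals \<open>L\<close>. As \<open>p' \<notin> L\<close>, the point \<open>a\<close> is not on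
  \<open>L\<close>, and then \<open>S - {x}\<close> contains \<open>p, y \<in> L\<close> and \<open>a \<notin> L\<close>, so its hull is everything.
  Conversely, two points of a line together with a vertex that is collinear with neither
  of them form an \<open>E\<close>-independent set.
\<close>

text \<open>Rotating the cycle so that it starts with the arc leaving \<open>v\<close> makes
  \<open>e1\<close>, \<open>e2\<close> its first two arcs and \<open>e3\<close> its last. In a
  triangle \<open>head X e2\<close> coincides with \<open>tail X e3\<close>, so these two are not
  separated.\<close>

lemma cycle_throughE:
  assumes "cycle_through X v"
  obtains e1 e2 e3 where "{e1, e2, e3} \<subseteq> arcs X" "tail X e1 = v" "tail X e2 = head X e1"
    "head X e3 = v" "head X e1 \<noteq> v" "head X e2 \<noteq> v" "tail X e3 \<noteq> v" "tail X e3 \<noteq> head X e1"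
proof -
  interpret pre_digraph X .
  obtain p u e where p: "awalk u p u" "distinct (tl (awalk_verts u p))" "3 \<le> length p"
      "e \<in> set p" "tail X e = v"
    using assms by (auto simp: cycle_through_def cycle_def)
  obtain q r where q: "p = q @ e # r" using p(4) by (meson split_list)
  have cas: "cas u (q @ e # r) u" using p(1) by (simp add: awalk_def q)
  \<comment> \<open>Distinctness of the arc heads, unlike that of the vertex list, visibly survives
    the rotation.\<close>
  have "distinct (map (head X) p)" using awalk_verts_conv'[OF cas] p(2) by (simp add: q)
  then have dist: "distinct (map (head X) (e # r @ q))" by (auto simp: q)
  have last: "awlast a s = b" if "cas a s b" for a s b
    using that by (induct s arbitrary: a) auto
  have "cas u q v" "cas (head X e) r u" using cas p(5) by auto
  then have cas': "cas v (e # r @ q) v" using p(5) last[of "head X e" r u] by simp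
  have "2 \<le> length (r @ q)" using p(3) by (simp add: q)
  then obtain e2 t where "r @ q = e2 # t" "t \<noteq> []" by (cases "r @ q") force+
  then obtain s e3 where "r @ q = e2 # s @ [e3]" by (metis rev_exhaust)
  then have rq: "e # r @ q = e # e2 # s @ [e3]" by simp
  have "set (e # r @ q) \<subseteq> arcs X" using p(1) by (auto simp: awalk_def q)
  then have arcs: "{e, e2, e3} \<subseteq> arcs X" unfolding rq by simp
  have e3: "head X e3 = v" and e2: "tail X e2 = head X e"
    using cas' unfolding rq by auto
  \<comment> \<open>\<open>tail X e3\<close> is the head of an arc strictly between \<open>e\<close>
    and \<open>e3\<close>, so it differs from the heads of both.\<close>
  have "cas (tail X e2) (e2 # s) (tail X e3)" using cas' unfolding rq by auto
  then have "tail X e3 \<in> head X ` set (e2 # s)"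
    by (induct s arbitrary: e2) auto
  moreover have "v \<notin> head X ` set (e2 # s)" "head X e \<notin> head X ` set (e2 # s)"
    using dist e3 unfolding rq by auto
  ultimately have "tail X e3 \<noteq> v" "tail X e3 \<noteq> head X e" by metis+
  moreover have "head X e \<noteq> v" "head X e2 \<noteq> v" using dist e3 unfolding rq by auto
  ultimately show ?thesis using arcs p(5) e2 e3 by (intro that)
qed

section \<open>Lines and convex sets in a product of complete graphs\<close>

locale complete_product =
  fixes G :: "'a pair_pre_digraph" and H :: "'b pair_pre_digraph" and m n :: nat
  assumes complete_G: "complete_digraph m (with_proj G)"
    and complete_H: "complete_digraph n (with_proj H)"
begin

abbreviation X where "X \<equiv> with_proj (G \<box> H)"

abbreviation V where "V \<equiv> pverts G \<times> pverts H"

text \<open>Reflexive, hence adjacency or equality for vertices of the product.\<close>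

definition collinear :: "'a \<times> 'b \<Rightarrow> 'a \<times> 'b \<Rightarrow> bool" where
  "collinear x y \<longleftrightarrow> fst x = fst y \<or> snd x = snd y"

definition lines :: "('a \<times> 'b) set set" where
  "lines = {{g} \<times> pverts H | g. g \<in> pverts G} \<union> {pverts G \<times> {h} | h. h \<in> pverts H}"

lemma pverts_product [simp]: "pverts (G \<box> H) = V"
  by (simp add: cartesian_product_def)

lemma parcs_product [simp]:
  "(x, y) \<in> parcs (G \<box> H) \<longleftrightarrow> x \<in> V \<and> y \<in> V \<and> x \<noteq> y \<and> collinear x y"
  using complete_G complete_H
  by (cases x; cases y) (auto simp: cartesian_product_def complete_digraph_pair_def collinear_def)

lemma cycle_convex_triangle:
  assumes C: "cycle_convex X C" and "u \<in> C" "w \<in> C" "v \<in> V" "u \<noteq> w"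
    and "collinear u w" "collinear v u" "collinear w v"
  shows "v \<in> C"
proof (rule ccontr)
  assume v: "v \<notin> C"
  have "C \<subseteq> V" using C by (simp add: cycle_convex_def)
  then have "pre_digraph.cycle (X \<restriction> (C \<union> {v})) [(v, u), (u, w), (w, v)]"
    using assms v unfolding pre_digraph.cycle_def
    by (intro exI[of _ v])
      (auto simp: pre_digraph.awalk_def pre_digraph.cas.simps pre_digraph.awalk_verts.simps)
  then have "cycle_through (X \<restriction> (C \<union> {v})) v"
    unfolding cycle_through_def by (intro exI[of _ "[(v, u), (u, w), (w, v)]"]) simp
  then show False using C v \<open>v \<in> V\<close> by (auto simp: cycle_convex_def cycle_interval_def)
qed

lemma cycle_convex_square:
  assumes C: "cycle_convex X C" and "u \<in> C" "w \<in> C" "z \<in> C" "v \<in> V" "u \<noteq> w" "u \<noteq> z" "w \<noteq> z"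
    and "collinear v u" "collinear u z" "collinear z w" "collinear w v"
  shows "v \<in> C"
proof (rule ccontr)
  assume v: "v \<notin> C"
  have "C \<subseteq> V" using C by (simp add: cycle_convex_def)
  then have "pre_digraph.cycle (X \<restriction> (C \<union> {v})) [(v, u), (u, z), (z, w), (w, v)]"
    using assms v unfolding pre_digraph.cycle_def
    by (intro exI[of _ v])
      (auto simp: pre_digraph.awalk_def pre_digraph.cas.simps pre_digraph.awalk_verts.simps)
  then have "cycle_through (X \<restriction> (C \<union> {v})) v"
    unfolding cycle_through_def by (intro exI[of _ "[(v, u), (u, z), (z, w), (w, v)]"]) simp
  then show False using C v \<open>v \<in> V\<close> by (auto simp: cycle_convex_def cycle_interval_def)
qed

text \<open>Here \<open>u\<close> and \<open>w\<close> are the neighbours of \<open>v\<close> on the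
  cycle and \<open>z\<close> is the vertex after \<open>u\<close>; \<open>z = w\<close> is the case
  of a triangle.\<close>

lemma cycle_intervalE:
  assumes "v \<in> cycle_interval X C" "C \<subseteq> V"
  obtains u w z where "u \<in> C" "w \<in> C" "z \<in> C" "v \<in> V" "v \<notin> C" "u \<noteq> w" "u \<noteq> z"
    "collinear v u" "collinear u z" "collinear w v"
proof -
  have v: "v \<in> V" "v \<notin> C" and "cycle_through (X \<restriction> (C \<union> {v})) v"
    using assms by (auto simp: cycle_interval_def)
  from this(3) show ?thesis
  proof (rule cycle_throughE)
    fix e1 e2 e3
    assume "{e1, e2, e3} \<subseteq> arcs (X \<restriction> (C \<union> {v}))"
      "tail (X \<restriction> (C \<union> {v})) e1 = v"
      "tail (X \<restriction> (C \<union> {v})) e2 = head (X \<restriction> (C \<union> {v})) e1"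
      "head (X \<restriction> (C \<union> {v})) e3 = v"
      "head (X \<restriction> (C \<union> {v})) e1 \<noteq> v" "head (X \<restriction> (C \<union> {v})) e2 \<noteq> v"
      "tail (X \<restriction> (C \<union> {v})) e3 \<noteq> v" "tail (X \<restriction> (C \<union> {v})) e3 \<noteq> head (X \<restriction> (C \<union> {v})) e1"
    then show ?thesis using v
      by (cases e1; cases e2; cases e3) (auto intro!: that[of "snd e1" "fst e3" "snd e2"])
  qed
qed

text \<open>A cycle through an outside vertex has an edge \<open>u\<close>, \<open>z\<close> with
  both ends in \<open>C\<close>.\<close>

lemma cycle_convex_if_not_collinear:
  assumes "C \<subseteq> V" "\<And>x y. x \<in> C \<Longrightarrow> y \<in> C \<Longrightarrow> x \<noteq> y \<Longrightarrow> \<not> collinear x y"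
  shows "cycle_convex X C"
proof -
  have "v \<notin> cycle_interval X C" for v
  proof
    assume "v \<in> cycle_interval X C"
    then show False using assms(1) by (rule cycle_intervalE) (use assms(2) in blast)
  qed
  then show ?thesis using assms(1) by (auto simp: cycle_convex_def)
qed

text \<open>A vertex off a line is collinear with only one point of it, whereas a cycle would supply
  two.\<close>

lemma cycle_convex_line:
  assumes "L \<in> lines"
  shows "cycle_convex X L"
proof -
  have L: "L \<subseteq> V" using assms by (auto simp: lines_def)
  have False if v: "v \<in> cycle_interval X L" for v
    using v L
  proof (rule cycle_intervalE)
    fix u w assume "u \<in> L" "w \<in> L" "v \<in> V" "v \<notin> L" "u \<noteq> w" "collinear v u" "collinear w v"
    then show False using assms
      by (cases u; cases v; cases w) (auto simp: lines_def collinear_def)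
  qed
  then show ?thesis using L by (auto simp: cycle_convex_def)
qed

lemma collinear_in_line:
  assumes "x \<in> V" "y \<in> V" "collinear x y"
  obtains L where "L \<in> lines" "x \<in> L" "y \<in> L"
proof (cases "fst x = fst y")
  case True
  then show ?thesis using assms
    by (intro that[of "{fst x} \<times> pverts H"]) (auto simp: lines_def)
next
  case False
  then show ?thesis using assms
    by (intro that[of "pverts G \<times> {snd x}"]) (auto simp: lines_def collinear_def)
qed

lemma line_subset_cycle_convex:
  assumes C: "cycle_convex X C" and L: "L \<in> lines"
    and "x \<in> L" "y \<in> L" "x \<noteq> y" "x \<in> C" "y \<in> C"
  shows "L \<subseteq> C"
proof
  fix v assume "v \<in> L"
  then show "v \<in> C" using L assms(3-)
    by (intro cycle_convex_triangle[OF C, of x y v]) (auto simp: lines_def collinear_def)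
qed

text \<open>The line \<open>L'\<close> through \<open>z\<close> transversal to \<open>L\<close>
  meets it in a point \<open>y\<close>, so \<open>L'\<close> lies in \<open>C\<close> as well. Any
  other vertex completes a square with \<open>y\<close> and its projections to \<open>L\<close> and
  \<open>L'\<close>.\<close>

lemma cycle_convex_line_point:
  assumes C: "cycle_convex X C" and L: "L \<in> lines" and "L \<subseteq> C" "z \<in> C" "z \<notin> L"
  shows "C = V"
proof -
  have z: "z \<in> V" and CV: "C \<subseteq> V" using C assms(4) by (auto simp: cycle_convex_def)
  \<comment> \<open>The two directions of \<open>L\<close> are distinguished only here; the rest
    uses the projections abstractly.\<close>
  obtain L' y where L': "L' \<in> lines" "y \<in> L" "y \<in> L'" "z \<in> L'"
    and V: "\<And>v. v \<in> V - L - L' \<Longrightarrow>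
      \<exists>u\<in>L. \<exists>w\<in>L'. u \<noteq> y \<and> w \<noteq> y \<and> u \<noteq> w \<and>
        collinear v u \<and> collinear u y \<and> collinear y w \<and> collinear w v"
    using L unfolding lines_def
  proof (elim UnE CollectE exE conjE)
    fix g assume g: "L = {g} \<times> pverts H" "g \<in> pverts G"
    show thesis
    proof (rule that[of "pverts G \<times> {snd z}" "(g, snd z)"])
      fix v assume "v \<in> V - L - pverts G \<times> {snd z}"
      then show "\<exists>u\<in>L. \<exists>w\<in>pverts G \<times> {snd z}. u \<noteq> (g, snd z) \<and> w \<noteq> (g, snd z) \<and> u \<noteq> w \<and>
          collinear v u \<and> collinear u (g, snd z) \<and> collinear (g, snd z) w \<and> collinear w v"
        using g z by (intro bexI[of _ "(g, snd v)"] bexI[of _ "(fst v, snd z)"]) (auto simp: collinear_def)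
    qed (use g z in \<open>auto simp: lines_def\<close>)
  next
    fix h assume h: "L = pverts G \<times> {h}" "h \<in> pverts H"
    show thesis
    proof (rule that[of "{fst z} \<times> pverts H" "(fst z, h)"])
      fix v assume "v \<in> V - L - {fst z} \<times> pverts H"
      then show "\<exists>u\<in>L. \<exists>w\<in>{fst z} \<times> pverts H. u \<noteq> (fst z, h) \<and> w \<noteq> (fst z, h) \<and> u \<noteq> w \<and>
          collinear v u \<and> collinear u (fst z, h) \<and> collinear (fst z, h) w \<and> collinear w v"
        using h z by (intro bexI[of _ "(fst v, h)"] bexI[of _ "(fst z, snd v)"]) (auto simp: collinear_def)
    qed (use h z in \<open>auto simp: lines_def\<close>)
  qed
  have "y \<in> C" "y \<noteq> z" using L' assms by auto
  then have "L' \<subseteq> C" using line_subset_cycle_convex[OF C L'(1)] L' assms(4) by blast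
  have "v \<in> C" if "v \<in> V" for v
  proof (cases "v \<in> L \<union> L'")
    case True
    then show ?thesis using \<open>L \<subseteq> C\<close> \<open>L' \<subseteq> C\<close> by auto
  next
    case False
    then have "v \<in> V - L - L'" using that by blast
    from V[OF this] obtain u w where "u \<in> L" "w \<in> L'" "u \<noteq> y" "w \<noteq> y" "u \<noteq> w"
        "collinear v u" "collinear u y" "collinear y w" "collinear w v"
      by blast
    then show ?thesis
      using cycle_convex_square[OF C, of u w y v] \<open>y \<in> C\<close> \<open>L \<subseteq> C\<close> \<open>L' \<subseteq> C\<close> that by blast
  qed
  then show ?thesis using CV by auto
qed

section \<open>Hulls and the exchange number\<close>

lemma cycle_hull_eq_line_or_V:
  assumes "S \<subseteq> V" "L \<in> lines" "x \<in> L" "y \<in> L" "x \<noteq> y" "x \<in> S" "y \<in> S"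
  shows "cycle_hull X S = (if S \<subseteq> L then L else V)"
proof -
  have S: "S \<subseteq> verts X" using assms(1) by simp
  note hull = cycle_hull_least[OF S]
  have L: "L \<subseteq> cycle_hull X S"
    using line_subset_cycle_convex[OF hull(1) assms(2-5)] hull(2) assms(6,7) by blast
  show ?thesis
  proof (cases "S \<subseteq> L")
    case True
    then show ?thesis using L hull(3)[OF cycle_convex_line[OF assms(2)]] by auto
  next
    case False
    then show ?thesis using cycle_convex_line_point[OF hull(1) assms(2) L] hull(2) by auto
  qed
qed

lemma cycle_hull_not_collinear:
  assumes "S \<subseteq> V" "\<And>x y. x \<in> S \<Longrightarrow> y \<in> S \<Longrightarrow> x \<noteq> y \<Longrightarrow> \<not> collinear x y"
  shows "cycle_hull X S = S"
  unfolding cycle_hull_def using cycle_convex_if_not_collinear[OF assms] by (rule hull_same)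

lemma card_E_independent_le_3:
  assumes "E_independent X S"
  shows "card S \<le> 3"
proof (rule ccontr)
  assume "\<not> card S \<le> 3"
  then have card: "card S \<ge> 4" by simp
  have SV: "S \<subseteq> V" using assms by (simp add: E_independent_def)
  obtain p p' where p: "p \<in> S"
      "p' \<in> cycle_hull X (S - {p}) - (\<Union>a\<in>S - {p}. cycle_hull X (S - {a}))"
    using assms card unfolding E_independent_def
    by (elim conjE disjE bexE exE) (simp, blast)
  then have p: "p \<in> S" "p' \<in> cycle_hull X (S - {p})"
      and p': "\<And>a. a \<in> S - {p} \<Longrightarrow> p' \<notin> cycle_hull X (S - {a})"
    by blast+
  have hull_V: "cycle_hull X (S - {p}) \<subseteq> V"
    using cycle_hull_least(1)[of "S - {p}" X] SV by (auto simp: cycle_convex_def)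
  \<comment> \<open>The arguments may coincide; this serves to avoid both \<open>{p, p'}\<close> and
    \<open>{p, x, y}\<close>.\<close>
  have fourth: "\<exists>a. a \<in> S - {x, y, z}" for x y z
  proof (rule ccontr)
    assume "\<not> ?thesis"
    then have "card S \<le> card {x, y, z}" by (intro card_mono) auto
    also have "\<dots> \<le> 3" by (simp add: card_insert_if)
    finally show False using card by simp
  qed
  have "p' \<notin> S - {p}"
  proof
    assume "p' \<in> S - {p}"
    moreover obtain a where "a \<in> S - {p, p'}" using fourth[of p p' p'] by auto
    moreover have "S - {a} \<subseteq> cycle_hull X (S - {a})"
      using SV by (intro cycle_hull_least(2)) auto
    ultimately show False using p'[of a] by auto
  qed
  then have "cycle_hull X (S - {p}) \<noteq> S - {p}" using p(2) by auto
  then obtain x y where xy: "x \<in> S - {p}" "y \<in> S - {p}" "x \<noteq> y" "collinear x y"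
    using cycle_hull_not_collinear[of "S - {p}"] SV by blast
  then obtain L where L: "L \<in> lines" "x \<in> L" "y \<in> L"
    using collinear_in_line[of x y] SV by blast
  obtain a where a: "a \<in> S - {p, x, y}" using fourth by blast
  have hull: "cycle_hull X T = (if T \<subseteq> L then L else V)"
    if "T \<subseteq> S" "u \<in> T" "w \<in> T" "u \<noteq> w" "u \<in> L" "w \<in> L" for T u w
    using that SV L by (intro cycle_hull_eq_line_or_V[of T L u w]) auto
  have "p' \<notin> cycle_hull X (S - {a})" using p' a by auto
  \<comment> \<open>The hull is \<open>L\<close> or \<open>V\<close>, and \<open>V\<close> is
    excluded because it contains \<open>p'\<close>.\<close>
  then have "S - {a} \<subseteq> L" "p' \<notin> L"
    using hull[of "S - {a}" x y] xy a L hull_V p(2) by (auto split: if_splits)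
  moreover have "\<not> S - {p} \<subseteq> L"
    using hull[of "S - {p}" x y] xy L p(2) \<open>p' \<notin> L\<close> by auto
  \<comment> \<open>Some point of \<open>S - {p}\<close> is off \<open>L\<close>, and only
    \<open>a\<close> can be.\<close>
  ultimately have "a \<notin> L" "p \<in> L" using a p(1) by auto
  moreover from this have "\<not> S - {x} \<subseteq> L" using a by blast
  moreover have "p \<in> S - {x}" "y \<in> S - {x}" "p \<noteq> y" using xy p(1) by auto
  ultimately have "cycle_hull X (S - {x}) = V"
    using hull[of "S - {x}" p y] L(3) by simp
  then show False using p'[of x] xy(1) p(2) hull_V by auto
qed

lemma E_independent_card_3:
  assumes "2 \<le> m" "3 \<le> n"
  obtains S where "E_independent X S" "card S = 3"
proof -
  have "2 \<le> card (pverts G)" "3 \<le> card (pverts H)"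
    using complete_G complete_H assms by (auto simp: complete_digraph_pair_def)
  then obtain A B where AB: "A \<subseteq> pverts G" "card A = 2" "B \<subseteq> pverts H" "card B = 3"
    by (metis obtain_subset_with_card_n)
  obtain g g' where g: "g \<in> pverts G" "g' \<in> pverts G" "g \<noteq> g'"
    using AB(1,2) by (auto simp: card_2_iff)
  obtain h h' h'' where h: "h \<in> pverts H" "h' \<in> pverts H" "h'' \<in> pverts H"
      "h \<noteq> h'" "h \<noteq> h''" "h' \<noteq> h''"
    using AB(3,4) by (auto simp: card_3_iff)
  \<comment> \<open>The point to remove is \<open>(g', h'')\<close> and the witness is
    \<open>(g, h'')\<close>: it lies on the line of the first two points, while the other two pairs
    are not collinear and hence are their own hulls.\<close>
  define S where "S = {(g, h), (g, h'), (g', h'')}"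
  have "S - {(g', h'')} = {(g, h), (g, h')}" "S - {(g, h)} = {(g, h'), (g', h'')}"
      "S - {(g, h')} = {(g, h), (g', h'')}"
    using g h by (auto simp: S_def)
  moreover have "cycle_hull X {(g, h), (g, h')} = {g} \<times> pverts H"
    using g h by (subst cycle_hull_eq_line_or_V[of _ "{g} \<times> pverts H" "(g, h)" "(g, h')"])
      (auto simp: lines_def)
  moreover have "cycle_hull X {(g, h'), (g', h'')} = {(g, h'), (g', h'')}"
      "cycle_hull X {(g, h), (g', h'')} = {(g, h), (g', h'')}"
    using g h by (auto intro!: cycle_hull_not_collinear simp: collinear_def)
  ultimately have "(g, h'') \<in> cycle_hull X (S - {(g', h'')}) -
      (\<Union>a\<in>S - {(g', h'')}. cycle_hull X (S - {a}))"
    using g h by auto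
  then have "E_independent X S"
    using g h unfolding E_independent_def by (auto simp: S_def)
  moreover have "card S = 3" using g h by (simp add: S_def)
  ultimately show ?thesis by (rule that)
qed

end

theorem theorem8:
  fixes G :: "'a pair_pre_digraph" and H :: "'b pair_pre_digraph" and m n :: nat
  assumes "m \<ge> 3" and "n \<ge> 3"
    and "complete_digraph m (with_proj G)" and "complete_digraph n (with_proj H)"
  shows "exchange_number (with_proj (G \<box> H)) = 3"
proof -
  interpret complete_product G H m n using assms by unfold_locales
  obtain S where "E_independent X S" "card S = 3"
    using E_independent_card_3 assms(1,2) by auto
  \<comment> \<open>The upper bound also gives the finiteness that \<open>Max\<close> relies
    on.\<close>
  moreover have "finite {card S | S. E_independent X S}"
    by (rule finite_subset[of _ "{..3}"]) (auto dest: card_E_independent_le_3)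
  ultimately show ?thesis
    unfolding exchange_number_def by (intro Max_eqI) (auto dest: card_E_independent_le_3)
qed

end
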